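(* Let $0<p<1$, $A\in\mathbb{R}^{m\times n}$, $\bm{b}\in\mathbb{R}^m$ and $\sigma\ge0$ be such that $\{\bm{x}\in\mathbb{R}^n:\|A\bm{x}-\bm{b}\|_1\le\sigma\}\ne\emptyset$ and $\|\bm{b}\|_1>\sigma$. Suppose that $\bm{x}^*$ is a global minimizer of $$\min_{\bm{x}\in\mathbb{R}^n}\ \|\bm{x}\|_p^p\quad\text{s.t.}\quad\|A\bm{x}-\bm{b}\|_1\le\sigma .$$ Then, for any $\epsilon>0$, there exists a $\lambda_\epsilon^*>0$ such that $\bm{x}^*$ is an $\epsilon$-minimizer of the penalty problem $\min_{\bm{x}\in\mathbb{R}^n}F_\lambda(\bm{x})$ whenever $\lambda\ge\lambda_\epsilon^*$, where $F_\lambda(\bm{x}):=\|\bm{x}\|_p^p+\lambda\,(\|A\bm{x}-\bm{b}\|_1-\sigma)_+$.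
   Context: $\|\bm{x}\|_p^p:=\sum_{i=1}^n|x_i|^p$ and $(\cdot)_+:=\max\{\cdot,0\}$. For $\epsilon>0$, a point $\bm{x}_\epsilon$ is an $\epsilon$-minimizer of $\min_{\bm{x}\in\mathbb{R}^n}F_\lambda(\bm{x})$ if $F_\lambda(\bm{x}_\epsilon)\le\min_{\bm{x}\in\mathbb{R}^n}F_\lambda(\bm{x})+\epsilon$. *)

theory Defs
  imports "HOL-Analysis.Analysis"
begin

definition l1_norm :: "real ^ 'm \<Rightarrow> real" where
  "l1_norm y = (\<Sum>i\<in>UNIV. \<bar>y $ i\<bar>)"

(* The p-th power of the l_p quasi-norm.  Zero entries contribute 0 because 0 powr p = 0. *)
definition lp_pow :: "real \<Rightarrow> real ^ 'n \<Rightarrow> real" where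
  "lp_pow p x = (\<Sum>i\<in>UNIV. \<bar>x $ i\<bar> powr p)"

definition feasible_set :: "real ^ 'n ^ 'm \<Rightarrow> real ^ 'm \<Rightarrow> real \<Rightarrow> (real ^ 'n) set" where
  "feasible_set A b \<sigma> = {x. l1_norm (A *v x - b) \<le> \<sigma>}"

definition penalty_fun ::
  "real \<Rightarrow> real ^ 'n ^ 'm \<Rightarrow> real ^ 'm \<Rightarrow> real \<Rightarrow> real \<Rightarrow> real ^ 'n \<Rightarrow> real" where
  "penalty_fun p A b \<sigma> lam x = lp_pow p x + lam * max (l1_norm (A *v x - b) - \<sigma>) 0"

(* The minimum is required to be attained (at z), so that F z is its value;
   no convention for a non-existent minimum is involved. *)
definition eps_minimizer :: "real \<Rightarrow> ('a \<Rightarrow> real) \<Rightarrow> 'a \<Rightarrow> bool" where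
  "eps_minimizer \<epsilon> F x \<longleftrightarrow> (\<exists>z. is_arg_min F (\<lambda>_. True) z \<and> F x \<le> F z + \<epsilon>)"

end

theory Submission
  imports Defs
begin

text \<open>
  The sublevel sets of the objective \<open>f\<close> are compact, so the penalty function
  \<open>f + \<lambda> h\<close> attains its minimum already on the sublevel set at the height of the
  constrained minimum \<open>M\<close>. On the compact set where \<open>f \<le> M - \<epsilon>\<close> no point is
  feasible, so the constraint violation \<open>h\<close> is bounded below there by some
  \<open>\<delta> > 0\<close>, and \<open>\<lambda> \<ge> M / \<delta>\<close> lifts the penalty function above \<open>M\<close>.
\<close>

lemma penalty_eps_minimizer:
  fixes f h :: "'a::topological_space \<Rightarrow> real"
  assumes f: "continuous_on UNIV f" "\<And>x. 0 \<le> f x" "\<And>c. compact {x. f x \<le> c}"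
    and h: "continuous_on UNIV h" "\<And>x. 0 \<le> h x"
    and min: "is_arg_min f (\<lambda>x. h x = 0) xs"
    and "0 < \<epsilon>"
  shows "\<exists>l>0. \<forall>lam\<ge>l. eps_minimizer \<epsilon> (\<lambda>x. f x + lam * h x) xs"
proof -
  have opt: "f xs \<le> f y" if "h y = 0" for y
    using min that by (auto simp: is_arg_min_def not_less)
  have hxs: "h xs = 0"
    using min by (simp add: is_arg_min_def)
  obtain \<delta> where "\<delta> > 0" and \<delta>: "\<And>x. f x \<le> f xs - \<epsilon> \<Longrightarrow> \<delta> \<le> h x"
  proof (cases "{x. f x \<le> f xs - \<epsilon>} = {}")
    case True
    \<comment> \<open>No point has so small a value, so the bound is vacuous and any positive number
      serves as \<open>\<delta>\<close>.\<close>
    then show thesis using that[of 1] by auto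
  next
    case False
    obtain z where z: "f z \<le> f xs - \<epsilon>" "\<And>x. f x \<le> f xs - \<epsilon> \<Longrightarrow> h z \<le> h x"
      using continuous_attains_inf[OF f(3) False continuous_on_subset[OF h(1)]] by auto
    have "h z \<noteq> 0" using opt[of z] z(1) \<open>0 < \<epsilon>\<close> by auto
    then have "0 < h z" using h(2)[of z] by linarith
    with z(2) that show thesis by blast
  qed
  show ?thesis
  \<comment> \<open>The quotient ensures \<open>f xs \<le> lam * \<delta>\<close>; the added 1 keeps
    the threshold positive even if \<open>f xs = 0\<close>.\<close>
  proof (intro exI[of _ "f xs / \<delta> + 1"] conjI allI impI)
    show "0 < f xs / \<delta> + 1"
      using f(2)[of xs] \<open>\<delta> > 0\<close> by (simp add: add_nonneg_pos)
    fix lam assume lam: "f xs / \<delta> + 1 \<le> lam"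
    have "0 \<le> f xs / \<delta>" using f(2)[of xs] \<open>\<delta> > 0\<close> by simp
    then have "0 \<le> lam" using lam by linarith
    have lam_ge: "f xs \<le> lam * \<delta>"
      using lam \<open>\<delta> > 0\<close> by (simp add: pos_divide_le_eq[symmetric])
    let ?F = "\<lambda>x. f x + lam * h x"
    have F_ge: "f x \<le> ?F x" for x
      using \<open>0 \<le> lam\<close> h(2) by simp
    have "continuous_on {x. f x \<le> f xs} ?F"
      by (intro continuous_intros continuous_on_subset[OF f(1)] continuous_on_subset[OF h(1)]) auto
    then obtain z where z: "f z \<le> f xs" "\<And>x. f x \<le> f xs \<Longrightarrow> ?F z \<le> ?F x"
      using continuous_attains_inf[OF f(3)[of "f xs"], of ?F] by auto
    \<comment> \<open>Minimality over the sublevel set is global: outside it,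
      \<open>?F x \<ge> f x > f xs = ?F xs \<ge> ?F z\<close>, since
      \<open>h xs = 0\<close>.\<close>
    have "?F z \<le> ?F x" for x
    proof (cases "f x \<le> f xs")
      case False
      then show ?thesis using z(2)[of xs] F_ge[of x] hxs by auto
    qed (use z in auto)
    then have "is_arg_min ?F (\<lambda>_. True) z"
      by (auto simp: is_arg_min_def not_less)
    moreover have "?F xs \<le> ?F z + \<epsilon>"
    \<comment> \<open>In the first case the penalty at \<open>z\<close> alone is at least
      \<open>f xs\<close>; in the second, \<open>f z\<close> alone exceeds
      \<open>f xs - \<epsilon>\<close>.\<close>
    proof (cases "f z \<le> f xs - \<epsilon>")
      case True
      have "f xs \<le> lam * h z"
        using lam_ge mult_left_mono[OF \<delta>[OF True] \<open>0 \<le> lam\<close>] by linarith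
      then show ?thesis using f(2)[of z] \<open>0 < \<epsilon>\<close> hxs by simp
    next
      case False
      then show ?thesis using F_ge[of z] hxs by simp
    qed
    ultimately show "eps_minimizer \<epsilon> ?F xs"
      unfolding eps_minimizer_def by blast
  qed
qed

lemma lp_pow_nonneg: "0 \<le> lp_pow p x"
  by (simp add: lp_pow_def sum_nonneg)

lemma continuous_on_lp_pow: "0 < p \<Longrightarrow> continuous_on S (lp_pow p)"
  unfolding lp_pow_def by (intro continuous_intros continuous_on_powr') auto

text \<open>Each term of the sum is at most the whole, so every coordinate is bounded by
  \<open>c powr (1 / p)\<close>; continuity gives closedness.\<close>

lemma compact_lp_pow_sublevel:
  fixes c :: real
  assumes "0 < p"
  shows "compact {x :: real ^ 'n. lp_pow p x \<le> c}"
proof -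
  have "norm x \<le> (\<Sum>i\<in>(UNIV :: 'n set). c powr (1 / p))"
    if "lp_pow p x \<le> c" for x :: "real ^ 'n"
  proof -
    have "\<bar>x $ i\<bar> \<le> c powr (1 / p)" for i
    proof -
      have "\<bar>x $ i\<bar> powr p \<le> lp_pow p x"
        unfolding lp_pow_def by (rule member_le_sum) auto
      then have "(\<bar>x $ i\<bar> powr p) powr (1 / p) \<le> c powr (1 / p)"
        using that assms by (intro powr_mono2) auto
      then show ?thesis using assms by (simp add: powr_powr)
    qed
    then show ?thesis
      by (intro order_trans[OF norm_le_l1_cart sum_mono])
  qed
  then have "bounded {x :: real ^ 'n. lp_pow p x \<le> c}"
    unfolding bounded_iff by blast
  moreover have "closed {x :: real ^ 'n. lp_pow p x \<le> c}"
    by (intro closed_Collect_le continuous_on_lp_pow[OF assms] continuous_intros)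
  ultimately show ?thesis by (simp add: compact_eq_bounded_closed)
qed

theorem theoremC2:
  fixes A :: "real ^ 'n ^ 'm" and b :: "real ^ 'm" and p \<sigma> :: real
    and xstar :: "real ^ 'n"
  assumes "0 < p" and "p < 1" and "\<sigma> \<ge> 0"
    and "feasible_set A b \<sigma> \<noteq> {}"
    and "l1_norm b > \<sigma>"
    and "is_arg_min (lp_pow p) (\<lambda>x. x \<in> feasible_set A b \<sigma>) xstar"
  shows "\<forall>\<epsilon>>0. \<exists>lam_star>0. \<forall>lam\<ge>lam_star.
           eps_minimizer \<epsilon> (penalty_fun p A b \<sigma> lam) xstar"
proof (intro allI impI)
  fix \<epsilon> :: real assume "\<epsilon> > 0"
  let ?h = "\<lambda>x. max (l1_norm (A *v x - b) - \<sigma>) 0"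
  have "continuous_on UNIV ?h"
    unfolding l1_norm_def
    by (intro continuous_intros linear_continuous_on matrix_vector_mul_bounded_linear)
  \<comment> \<open>Feasibility becomes the vanishing of a nonnegative continuous function, the form
    in which \<open>penalty_eps_minimizer\<close> expects the constraint.\<close>
  moreover have "x \<in> feasible_set A b \<sigma> \<longleftrightarrow> ?h x = 0" for x
    by (auto simp: feasible_set_def)
  ultimately show "\<exists>lam_star>0. \<forall>lam\<ge>lam_star. eps_minimizer \<epsilon> (penalty_fun p A b \<sigma> lam) xstar"
    unfolding penalty_fun_def[abs_def] using assms(1,6) \<open>\<epsilon> > 0\<close>
    by (intro penalty_eps_minimizer)
      (auto simp: continuous_on_lp_pow lp_pow_nonneg compact_lp_pow_sublevel)
qed

end
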